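(* For every positive integer $n$, with $X=[3;n]=3+\tfrac1n=\tfrac{3n+1}{n}$, one has $$\mathrm{F}([3;n])=L_{n+1},$$ where $L_{n+1}$ is the $(n+1)$-th Lucas number.
   Context: The conumerator function is the unique map $\mathrm{con}:\mathbb{Q}_{>0}\to\mathbb{Z}_{>0}$ with $\mathrm{con}(1)=1$ and, for all $X\in\mathbb{Q}_{>0}$, $\mathrm{con}(1+X)=\mathrm{con}(X)+\mathrm{con}(1/X)$ and $\mathrm{con}\left(\tfrac{1}{1+X}\right)=\mathrm{con}(X)$. The codenominator function is $\mathrm{F}(X):=\mathrm{con}(1/X)$ for $X\in\mathbb{Q}_{>0}$; equivalently $\mathrm{F}(1)=1$, $\mathrm{F}(1+X)=\mathrm{F}(1/X)$, $\mathrm{F}\left(\tfrac{1}{1+X}\right)=\mathrm{F}(X)+\mathrm{F}(1/X)$. The Lucas numbers are $L_0=2$, $L_1=1$, $L_n=L_{n-1}+L_{n-2}$. *)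

theory Defs
  imports Complex_Main
begin

section \<open>Conumerator and codenominator\<close>

text \<open>The positive rationals are represented by the positive elements of \<^typ>\<open>rat\<close>.
  The value 0 outside the domain carries no mathematical content; it only makes the total
  function unique.\<close>

definition is_conumerator :: "(rat \<Rightarrow> nat) \<Rightarrow> bool" where
  "is_conumerator c \<longleftrightarrow>
     (\<forall>X>0. c X > 0) \<and>
     c 1 = 1 \<and>
     (\<forall>X>0. c (1 + X) = c X + c (1 / X)) \<and>
     (\<forall>X>0. c (1 / (1 + X)) = c X) \<and>
     (\<forall>X\<le>0. c X = 0)"

definition conumerator :: "rat \<Rightarrow> nat" where
  "conumerator = (THE c. is_conumerator c)"

definition codenominator :: "rat \<Rightarrow> nat" where
  "codenominator X = conumerator (1 / X)"


section \<open>Finite continued fractions and Lucas numbers\<close>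

text \<open>\<open>cont_frac [a\<^sub>0, a\<^sub>1, \<dots>, a\<^sub>k]\<close> is $[a_0; a_1, \dots, a_k]$; the value at
  \<open>[]\<close> is a dummy.\<close>

fun cont_frac :: "nat list \<Rightarrow> rat" where
  "cont_frac [] = 0"
| "cont_frac [a] = of_nat a"
| "cont_frac (a # b # bs) = of_nat a + 1 / cont_frac (b # bs)"

fun lucas :: "nat \<Rightarrow> nat" where
  "lucas 0 = 2"
| "lucas (Suc 0) = 1"
| "lucas (Suc (Suc n)) = lucas (Suc n) + lucas n"

lemma cont_frac_3_n:
  assumes "n > 0"
  shows "cont_frac [3, n] = 3 + 1 / of_nat n"
    and "cont_frac [3, n] = (3 * of_nat n + 1) / of_nat n"
  using assms by (simp_all add: field_simps)


section \<open>Existence and uniqueness of the conumerator\<close>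

text \<open>Subtractive Euclidean algorithm on a pair \<open>(p, q)\<close> standing for the fraction \<open>p / q\<close>.\<close>

function con_aux :: "nat \<Rightarrow> nat \<Rightarrow> nat" where
  "con_aux p q =
     (if p = 0 \<or> q = 0 then 0
      else if p = q then 1
      else if q < p then con_aux (p - q) q + con_aux q (p - q)
      else con_aux (q - p) p)"
  by auto
termination by (relation "measure (\<lambda>(p, q). p + q)") auto

declare con_aux.simps [simp del]

lemma con_aux_pos: "p > 0 \<Longrightarrow> q > 0 \<Longrightarrow> con_aux p q > 0"
proof (induction "p + q" arbitrary: p q rule: less_induct)
  case less
  show ?case
  proof (cases "q < p")
    case True
    then have "con_aux (p - q) q > 0" using less by simp
    then show ?thesis using True less.prems by (subst con_aux.simps) simp
  next
    case False
    have "con_aux (q - p) p > 0" if "p \<noteq> q" using less False that by simp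
    then show ?thesis using False less.prems by (subst con_aux.simps) simp
  qed
qed

definition con_rat :: "rat \<Rightarrow> nat" where
  "con_rat X = (case quotient_of X of (p, q) \<Rightarrow> con_aux (nat p) (nat q))"

lemma rat_pos_fraction:
  fixes X :: rat
  assumes "X > 0"
  obtains p q :: nat where "p > 0" "q > 0" "coprime p q" "X = of_nat p / of_nat q"
proof -
  obtain a b where ab: "quotient_of X = (a, b)" by fastforce
  have b: "b > 0" using quotient_of_denom_pos[OF ab] .
  have X: "X = of_int a / of_int b" using quotient_of_div[OF ab] .
  have a: "a > 0" using X b assms by (simp add: zero_less_divide_iff)
  have "coprime (nat a) (nat b)"
    using quotient_of_coprime[OF ab] a b
    by (metis coprime_int_iff nat_0_le order_less_imp_le)
  moreover have "X = of_nat (nat a) / of_nat (nat b)" using X a b by simp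
  ultimately show ?thesis using that[of "nat a" "nat b"] a b by simp
qed

lemma con_rat_fraction:
  assumes "p > 0" "q > 0" "coprime p q"
  shows "con_rat (of_nat p / of_nat q) = con_aux p q"
proof -
  have "(of_nat p / of_nat q :: rat) = Fract (int p) (int q)"
    by (simp add: Fract_of_int_quotient)
  then have "quotient_of (of_nat p / of_nat q :: rat) = (int p, int q)"
    using assms by (simp add: quotient_of_Fract normalize_stable)
  then show ?thesis by (simp add: con_rat_def)
qed

lemma is_conumerator_con_rat: "is_conumerator con_rat"
  unfolding is_conumerator_def
proof (intro conjI allI impI)
  show "con_rat 1 = 1"
    using con_rat_fraction[of 1 1] by (simp add: con_aux.simps)
  fix X :: rat
  {
    assume "X > 0"
    then obtain p q :: nat where pq: "p > 0" "q > 0" "coprime p q" "X = of_nat p / of_nat q"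
      by (rule rat_pos_fraction)
    have cop: "coprime (p + q) q" "coprime q (p + q)" "coprime q p"
      using pq(3) by (metis gcd_add1 coprime_iff_gcd_eq_1 gcd.commute)+
    have "1 + X = of_nat (p + q) / of_nat q" "1 / X = of_nat q / of_nat p"
      "1 / (1 + X) = of_nat q / of_nat (p + q)"
      using pq(1,2) unfolding pq(4) by (simp_all add: field_simps)
    then have c: "con_rat (1 + X) = con_aux (p + q) q" "con_rat (1 / X) = con_aux q p"
      "con_rat (1 / (1 + X)) = con_aux q (p + q)" "con_rat X = con_aux p q"
      using pq cop by (simp_all only: con_rat_fraction add_pos_pos)
    show "con_rat X > 0" using c(4) con_aux_pos pq by simp
    show "con_rat (1 + X) = con_rat X + con_rat (1 / X)"
      using pq unfolding c by (subst con_aux.simps) simp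
    show "con_rat (1 / (1 + X)) = con_rat X"
      using pq unfolding c by (subst con_aux.simps) simp
  }
  assume "X \<le> 0"
  obtain a b where ab: "quotient_of X = (a, b)" by fastforce
  have "a \<le> 0"
    using quotient_of_denom_pos[OF ab] quotient_of_div[OF ab] \<open>X \<le> 0\<close>
    by (simp add: divide_le_0_iff)
  then show "con_rat X = 0" by (simp add: con_rat_def ab con_aux.simps)
qed

lemma is_conumerator_unique:
  assumes c: "is_conumerator c" and d: "is_conumerator d"
  shows "c = d"
proof
  fix X :: rat
  have *: "c (of_nat p / of_nat q) = d (of_nat p / of_nat q)" if "p > 0" "q > 0" for p q :: nat
    using that
  proof (induction "p + q" arbitrary: p q rule: less_induct)
    case less
    consider "p = q" | "q < p" | "p < q" by linarith
    then show ?case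
    proof cases
      case 1
      then show ?thesis using less.prems c d by (simp add: is_conumerator_def)
    next
      case 2
      define Y :: rat where "Y = of_nat (p - q) / of_nat q"
      have Y: "Y > 0" "of_nat p / of_nat q = 1 + Y" "1 / Y = of_nat q / of_nat (p - q)"
        using 2 less.prems by (simp_all add: Y_def field_simps of_nat_diff)
      have "c Y = d Y" "c (1 / Y) = d (1 / Y)"
        using less.hyps[of "p - q" q] less.hyps[of q "p - q"] less.prems 2
      unfolding Y(3) unfolding Y_def by (simp_all del: of_nat_diff)
      then show ?thesis using Y(1) c d unfolding Y(2) by (simp add: is_conumerator_def)
    next
      case 3
      define Y :: rat where "Y = of_nat (q - p) / of_nat p"
      have Y: "Y > 0" "of_nat p / of_nat q = 1 / (1 + Y)"
        using 3 less.prems by (simp_all add: Y_def field_simps of_nat_diff)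
      have "c Y = d Y" using less.hyps[of "q - p" p] less.prems 3 unfolding Y_def
        by (simp del: of_nat_diff)
      then show ?thesis using Y(1) c d unfolding Y(2) by (simp add: is_conumerator_def)
    qed
  qed
  show "c X = d X"
  proof (cases "X > 0")
    case True
    then show ?thesis using rat_pos_fraction * by metis
  next
    case False
    then show ?thesis using c d by (simp add: is_conumerator_def)
  qed
qed

lemma ex1_is_conumerator: "\<exists>!c. is_conumerator c"
  using is_conumerator_con_rat is_conumerator_unique by blast

lemma is_conumerator_conumerator: "is_conumerator conumerator"
  unfolding conumerator_def using ex1_is_conumerator by (rule theI')

lemma codenominator_1: "codenominator 1 = 1"
  and codenominator_1_plus:
    "X > 0 \<Longrightarrow> codenominator (1 + X) = codenominator (1 / X)"
  and codenominator_inverse_1_plus: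
    "X > 0 \<Longrightarrow> codenominator (1 / (1 + X)) = codenominator X + codenominator (1 / X)"
  using is_conumerator_conumerator by (simp_all add: is_conumerator_def codenominator_def)

end

theory Submission
  imports Defs "HOL-Number_Theory.Fib"
begin

text \<open>Write F for \<open>codenominator\<close> and y = 1/n. The functional equations strip the
  three units from 3 + y: F(3 + y) = F(1/(2 + y)) = F(1 + y) + F(1/(1 + y)) = 2 F(n) + F(1/n). By
  \<open>codenominator_nat_fib\<close> this is 2 fib(n) + fib(n+1) = fib(n) + fib(n+2), a Lucas
  number by \<open>lucas_Suc_eq_fib\<close>.\<close>

lemma codenominator_nat_fib:
  assumes "n > 0"
  shows "codenominator (of_nat n) = fib n"
    and "codenominator (1 / of_nat n) = fib (Suc n)"
  using assms
\<comment> \<open>Both claims share one induction: passing to n + 1 sends the pair (F(n), F(1/n)) to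
  (F(1/n), F(n) + F(1/n)), which is the Fibonacci shift.\<close>
proof (induction n rule: nat_induct_non_zero)
  case 1
  {
    case 1
    show ?case by (simp add: codenominator_1)
  next
    case 2
    show ?case by (simp add: codenominator_1)
  }
next
  case (Suc n)
  {
    case 1
    show ?case
      using codenominator_1_plus[of "of_nat n"] Suc by simp
  next
    case 2
    show ?case
      using codenominator_inverse_1_plus[of "of_nat n"] Suc by simp
  }
qed

text \<open>Both sides obey the Fibonacci recursion and agree at 0 and 1; \<open>fib.induct\<close>
  provides the two-step induction.\<close>

lemma lucas_Suc_eq_fib: "lucas (Suc n) = fib n + fib (n + 2)"
  by (induction n rule: fib.induct) simp_all

theorem lemma4p3:
  fixes n :: nat
  assumes "n > 0"
  shows "codenominator (cont_frac [3, n]) = lucas (n + 1)"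
proof -
  define y :: rat where "y = 1 / of_nat n"
  have y: "y > 0" "1 / y = of_nat n"
    using assms by (simp_all add: y_def)
  \<comment> \<open>Splitting 3 into units lets each equation remove one of them.\<close>
  have "codenominator (cont_frac [3, n]) = codenominator (1 + (1 + (1 + y)))"
    by (simp add: y_def algebra_simps)
  also have "\<dots> = codenominator (1 / (1 + (1 + y)))"
    using y by (intro codenominator_1_plus) simp
  also have "\<dots> = codenominator (1 + y) + codenominator (1 / (1 + y))"
    using y by (intro codenominator_inverse_1_plus) simp
  also have "\<dots> = codenominator (1 / y) + (codenominator y + codenominator (1 / y))"
    using y by (simp only: codenominator_1_plus codenominator_inverse_1_plus)
  also have "\<dots> = fib n + (fib (Suc n) + fib n)"
    using codenominator_nat_fib[OF assms] unfolding y(2) unfolding y_def by simp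
  also have "\<dots> = lucas (n + 1)"
    by (simp add: lucas_Suc_eq_fib)
  finally show ?thesis .
qed

end
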